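(* There is a set $A\subseteq\omega$ which is computably small but not intrinsically small.
   Context: For $A\subseteq\omega$ and $n\geq 1$, $\rho_n(A)=\frac{|A\cap\{0,\dots,n-1\}|}{n}$, $\overline{\rho}(A)=\limsup_n\rho_n(A)$, $\underline{\rho}(A)=\liminf_n\rho_n(A)$, and $\rho(A)$ is their common value when they agree. The computable upper density of $A$ is $\overline{R}(A)=\sup\{\overline{\rho}(f^{-1}(A)) : f:\omega\to\omega \text{ total, computable, strictly increasing}\}$, and the computable lower density $\underline{R}(A)$ is the analogous infimum of $\underline{\rho}(f^{-1}(A))$; if they agree their common value is the computable density $R(A)$. $A$ is computably small if $R(A)=0$. $A$ has intrinsic density $\alpha$ if $\rho(\pi(A))=\alpha$ for every computable permutation $\pi$ of $\omega$; $A$ is intrinsically small if it has intrinsic density $0$. *)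

theory Defs
  imports Complex_Main "HOL-Library.Extended_Real" "HOL-Library.Liminf_Limsup"
begin

text \<open>
  Computability is given by Kleene's partial \<open>\<mu>\<close>-recursive functions. Programs carry no
  arity: a program is run on an argument list, and \<open>run e xs y\<close> means that it halts on \<open>xs\<close>
  with output \<open>y\<close> (a wrong number of arguments makes it undefined). \<open>Zero\<close> is the constant
  zero of every arity, and the recursion variable of \<open>PrimRec\<close> and the search variable
  of \<open>Mu\<close> come first.
\<close>

datatype recf =
    Zero
  | Succ
  | Proj nat
  | Comp recf "recf list"
  | PrimRec recf recf
  | Mu recf

inductive run :: "recf \<Rightarrow> nat list \<Rightarrow> nat \<Rightarrow> bool" where
  run_Zero: "run Zero xs 0"
| run_Succ: "run Succ [x] (Suc x)"
| run_Proj: "i < length xs \<Longrightarrow> run (Proj i) xs (xs ! i)"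
| run_Comp: "list_all2 (\<lambda>g y. run g xs y) gs ys \<Longrightarrow> run f ys z \<Longrightarrow> run (Comp f gs) xs z"
| run_PrimRec_0: "run f xs y \<Longrightarrow> run (PrimRec f g) (0 # xs) y"
| run_PrimRec_Suc:
    "run (PrimRec f g) (n # xs) y \<Longrightarrow> run g (n # y # xs) z \<Longrightarrow> run (PrimRec f g) (Suc n # xs) z"
| run_Mu:
    "run f (n # xs) 0 \<Longrightarrow> (\<And>m. m < n \<Longrightarrow> \<exists>y. run f (m # xs) (Suc y)) \<Longrightarrow> run (Mu f) xs n"

lemma run_deterministic: "run e xs y \<Longrightarrow> run e xs z \<Longrightarrow> y = z"
proof (induction arbitrary: z rule: run.induct)
  case (run_Zero xs)
  then show ?case by (auto elim: run.cases)
next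
  case (run_Succ x)
  then show ?case by (auto elim: run.cases)
next
  case (run_Proj i xs)
  from run_Proj(2) show ?case by (cases rule: run.cases) auto
next
  case (run_Comp xs gs ys f w)
  from run_Comp.prems obtain ys' where
    ys': "list_all2 (\<lambda>g y. run g xs y) gs ys'" and f: "run f ys' z"
    by (cases rule: run.cases) auto
  have "ys = ys'"
    using run_Comp.IH(1) ys'
    by (auto simp: list_all2_conv_all_nth intro!: nth_equalityI)
  with f show ?case using run_Comp.IH(2) by blast
next
  case (run_PrimRec_0 f xs y g)
  from run_PrimRec_0.prems show ?case
    by (cases rule: run.cases) (auto dest: run_PrimRec_0.IH)
next
  case (run_PrimRec_Suc f g n xs y w)
  from run_PrimRec_Suc.prems obtain y' where
    "run (PrimRec f g) (n # xs) y'" "run g (n # y' # xs) z"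
    by (cases rule: run.cases) auto
  then show ?case using run_PrimRec_Suc.IH by blast
next
  case (run_Mu f n xs)
  from run_Mu.prems have z: "run f (z # xs) 0" "\<And>m. m < z \<Longrightarrow> \<exists>y. run f (m # xs) (Suc y)"
    by (cases rule: run.cases; auto)+
  show ?case
  proof (rule linorder_cases)
    assume "n < z"
    then show ?thesis using z(2) run_Mu.IH(1) by blast
  next
    assume "z < n"
    then show ?thesis using z(1) run_Mu.IH(2) by blast
  qed
qed

definition computable :: "(nat \<Rightarrow> nat) \<Rightarrow> bool" where
  "computable f \<longleftrightarrow> (\<exists>e. \<forall>x. run e [x] (f x))"

definition partial_density :: "nat set \<Rightarrow> nat \<Rightarrow> real" where
  "partial_density A n = real (card (A \<inter> {..<n})) / real n"

definition upper_density :: "nat set \<Rightarrow> ereal" where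
  "upper_density A = limsup (\<lambda>n. ereal (partial_density A n))"

definition lower_density :: "nat set \<Rightarrow> ereal" where
  "lower_density A = liminf (\<lambda>n. ereal (partial_density A n))"

definition has_density :: "nat set \<Rightarrow> real \<Rightarrow> bool" where
  "has_density A \<alpha> \<longleftrightarrow> upper_density A = ereal \<alpha> \<and> lower_density A = ereal \<alpha>"

definition computable_upper_density :: "nat set \<Rightarrow> ereal" where
  "computable_upper_density A =
    (SUP f \<in> {f. computable f \<and> strict_mono f}. upper_density (f -` A))"

definition computable_lower_density :: "nat set \<Rightarrow> ereal" where
  "computable_lower_density A =
    (INF f \<in> {f. computable f \<and> strict_mono f}. lower_density (f -` A))"

definition has_computable_density :: "nat set \<Rightarrow> real \<Rightarrow> bool" where
  "has_computable_density A \<alpha> \<longleftrightarrow>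
    computable_upper_density A = ereal \<alpha> \<and> computable_lower_density A = ereal \<alpha>"

definition computably_small :: "nat set \<Rightarrow> bool" where
  "computably_small A \<longleftrightarrow> has_computable_density A 0"

definition has_intrinsic_density :: "nat set \<Rightarrow> real \<Rightarrow> bool" where
  "has_intrinsic_density A \<alpha> \<longleftrightarrow> (\<forall>\<pi>. computable \<pi> \<and> bij \<pi> \<longrightarrow> has_density (\<pi> ` A) \<alpha>)"

definition intrinsically_small :: "nat set \<Rightarrow> bool" where
  "intrinsically_small A \<longleftrightarrow> has_intrinsic_density A 0"

end

theory Submission imports Defs "HOL-Library.Countable_Set" begin

text \<open>
  Cut \<open>\<omega>\<close> into rapidly growing blocks, and the \<open>j\<close>-th block into \<open>j + 1\<close> consecutive levels, each of
  them much larger than everything below it. The permutation \<open>\<pi>\<close> reverses every block. The set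
  \<open>A\<close> takes half of the reversal of one level from each block, so that \<open>\<pi> ` A\<close> has positive upper
  density. In the reversed block the larger levels come first: an increasing function that
  hits a considerable part of two levels meets the larger one before the smaller one, in
  which its density then stays negligible. Hence each of the first \<open>j\<close> computable increasing
  functions endangers at most one level of the \<open>j\<close>-th block, and the level used by \<open>A\<close> can be
  chosen to avoid them all; the functions that hit only a small part of the chosen level are
  avoided by removing their values from \<open>A\<close>.
\<close>

section \<open>Total recursive functions\<close>

text \<open>Programs carry no arity, so the length \<open>k\<close> fixes it; on lists of other
  lengths \<open>F\<close> is unconstrained. Argument lists let the closure lemmas below serve as
  introduction rules for any arity.\<close>

definition recursive :: "nat \<Rightarrow> (nat list \<Rightarrow> nat) \<Rightarrow> bool" where
  "recursive k F \<longleftrightarrow> (\<exists>e. \<forall>xs. length xs = k \<longrightarrow> run e xs (F xs))"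

definition recursive2 :: "(nat \<Rightarrow> nat \<Rightarrow> nat) \<Rightarrow> bool" where
  "recursive2 h \<longleftrightarrow> (\<exists>e. \<forall>x y. run e [x, y] (h x y))"

lemma computable_iff_recursive: "computable f \<longleftrightarrow> recursive 1 (\<lambda>xs. f (xs ! 0))"
proof -
  have "(\<forall>x. run e [x] (f x)) \<longleftrightarrow> (\<forall>xs. length xs = 1 \<longrightarrow> run e xs (f (xs ! 0)))" for e
    by (auto simp: length_Suc_conv)
  then show ?thesis by (simp add: computable_def recursive_def)
qed

lemma recursive2_iff_recursive: "recursive2 h \<longleftrightarrow> recursive 2 (\<lambda>xs. h (xs ! 0) (xs ! 1))"
proof -
  have "(\<forall>x y. run e [x, y] (h x y)) \<longleftrightarrow>
      (\<forall>xs. length xs = 2 \<longrightarrow> run e xs (h (xs ! 0) (xs ! 1)))" for e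
    by (force simp: length_Suc_conv numeral_2_eq_2)
  then show ?thesis by (simp add: recursive2_def recursive_def)
qed

lemma recursive_nth: "i < k \<Longrightarrow> recursive k (\<lambda>xs. xs ! i)"
  unfolding recursive_def by (rule exI[of _ "Proj i"]) (auto intro: run_Proj)

lemma recursive_Suc:
  assumes "recursive k F"
  shows "recursive k (\<lambda>xs. Suc (F xs))"
proof -
  obtain e where e: "\<And>xs. length xs = k \<Longrightarrow> run e xs (F xs)"
    using assms by (auto simp: recursive_def)
  have "run (Comp Succ [e]) xs (Suc (F xs))" if "length xs = k" for xs
    by (rule run_Comp[of _ _ "[F xs]"]) (auto intro: e that run_Succ)
  then show ?thesis by (auto simp: recursive_def)
qed

lemma recursive_comp1:
  assumes "computable f" and "recursive k F"
  shows "recursive k (\<lambda>xs. f (F xs))"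
proof -
  obtain e d where e: "\<And>xs. length xs = k \<Longrightarrow> run e xs (F xs)" and d: "\<And>x. run d [x] (f x)"
    using assms by (auto simp: recursive_def computable_def)
  have "run (Comp d [e]) xs (f (F xs))" if "length xs = k" for xs
    by (rule run_Comp[of _ _ "[F xs]"]) (auto intro: e that d)
  then show ?thesis by (auto simp: recursive_def)
qed

lemma recursive_comp2:
  assumes "recursive2 h" and "recursive k F" and "recursive k G"
  shows "recursive k (\<lambda>xs. h (F xs) (G xs))"
proof -
  obtain e e' d where e: "\<And>xs. length xs = k \<Longrightarrow> run e xs (F xs)"
    and e': "\<And>xs. length xs = k \<Longrightarrow> run e' xs (G xs)" and d: "\<And>x y. run d [x, y] (h x y)"
    using assms unfolding recursive_def recursive2_def by blast
  have "run (Comp d [e, e']) xs (h (F xs) (G xs))" if "length xs = k" for xs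
    by (rule run_Comp[of _ _ "[F xs, G xs]"]) (auto intro: e e' that d)
  then show ?thesis by (auto simp: recursive_def)
qed

lemma recursive_const: "recursive k (\<lambda>_. c)"
proof (induction c)
  case 0
  show ?case unfolding recursive_def by (rule exI[of _ Zero]) (auto intro: run_Zero)
next
  case (Suc c)
  then show ?case by (rule recursive_Suc)
qed

lemma recursive_primrec:
  assumes "recursive k F" and "recursive (Suc (Suc k)) G"
    and 0: "\<And>xs. length xs = k \<Longrightarrow> H (0 # xs) = F xs"
    and Suc: "\<And>n xs. length xs = k \<Longrightarrow> H (Suc n # xs) = G (n # H (n # xs) # xs)"
  shows "recursive (Suc k) H"
proof -
  obtain f g where f: "\<And>xs. length xs = k \<Longrightarrow> run f xs (F xs)"
    and g: "\<And>xs. length xs = Suc (Suc k) \<Longrightarrow> run g xs (G xs)"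
    using assms(1,2) unfolding recursive_def by blast
  have "run (PrimRec f g) (n # xs) (H (n # xs))" if xs: "length xs = k" for n xs
  proof (induction n)
    case 0
    show ?case using f[OF xs] by (simp add: assms(3) xs run_PrimRec_0)
  next
    case (Suc n)
    show ?case
      unfolding assms(4)[OF xs]
      by (rule run_PrimRec_Suc[OF Suc]) (simp add: g xs)
  qed
  then have "\<forall>xs. length xs = Suc k \<longrightarrow> run (PrimRec f g) xs (H xs)"
    by (auto simp: length_Suc_conv)
  then show ?thesis unfolding recursive_def by blast
qed

lemma recursive2_primrec:
  assumes "computable f" and "recursive 3 G"
    and "\<And>y. h 0 y = f y" and "\<And>n y. h (Suc n) y = G [n, h n y, y]"
  shows "recursive2 h"
proof -
  have "recursive (Suc 1) (\<lambda>xs. h (xs ! 0) (xs ! 1))"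
    using assms
    by (intro recursive_primrec[of 1 "\<lambda>xs. f (xs ! 0)" G])
      (auto simp: computable_iff_recursive length_Suc_conv numeral_3_eq_3)
  then show ?thesis by (simp add: recursive2_iff_recursive numeral_2_eq_2)
qed

lemma computable_primrec:
  assumes "recursive2 g" and Suc: "\<And>n. f (Suc n) = g n (f n)"
  shows "computable f"
proof -
  have "recursive (Suc 0) (\<lambda>xs. f (xs ! 0))"
    using assms
    by (intro recursive_primrec[of 0 "\<lambda>_. f 0" "\<lambda>xs. g (xs ! 0) (xs ! 1)"])
      (auto simp: recursive2_iff_recursive recursive_const numeral_2_eq_2)
  then show ?thesis by (simp add: computable_iff_recursive)
qed

lemma computable_id: "computable (\<lambda>x. x)"
  by (simp add: computable_iff_recursive recursive_nth)

lemma recursive2_swap: "recursive2 h \<Longrightarrow> recursive2 (\<lambda>x y. h y x)"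
  unfolding recursive2_iff_recursive[of "\<lambda>x y. h y x"]
  by (rule recursive_comp2) (auto intro: recursive_nth)

lemma recursive2_add: "recursive2 (+)"
proof (rule recursive2_primrec[of "\<lambda>y. y" "\<lambda>xs. Suc (xs ! 1)"])
  show "recursive 3 (\<lambda>xs. Suc (xs ! 1))"
    by (intro recursive_Suc recursive_nth) simp
qed (simp_all add: computable_id)

lemma recursive2_times: "recursive2 (*)"
proof (rule recursive2_primrec[of "\<lambda>_. 0" "\<lambda>xs. xs ! 2 + xs ! 1"])
  show "recursive 3 (\<lambda>xs. xs ! 2 + xs ! 1)"
    by (intro recursive_comp2[OF recursive2_add] recursive_nth) simp_all
qed (simp_all add: computable_iff_recursive recursive_const)

lemma recursive2_power: "recursive2 (^)"
proof -
  \<comment> \<open>The recursion variable comes first, so the exponent is put first and the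
    arguments are swapped afterwards.\<close>
  have "recursive2 (\<lambda>n x. x ^ n :: nat)"
  proof (rule recursive2_primrec[of "\<lambda>_. 1" "\<lambda>xs. xs ! 2 * xs ! 1"])
    show "recursive 3 (\<lambda>xs. xs ! 2 * xs ! 1)"
      by (intro recursive_comp2[OF recursive2_times] recursive_nth) simp_all
  qed (simp_all add: computable_iff_recursive recursive_const)
  then show ?thesis by (rule recursive2_swap)
qed

lemma computable_pred: "computable (\<lambda>n. n - 1)"
  by (rule computable_primrec[of "\<lambda>n _. n"])
    (auto simp: recursive2_iff_recursive intro: recursive_nth)

lemma recursive2_minus: "recursive2 (-)"
proof -
  have "recursive2 (\<lambda>n x. x - n :: nat)"
  proof (rule recursive2_primrec[of "\<lambda>x. x" "\<lambda>xs. xs ! 1 - 1"])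
    show "recursive 3 (\<lambda>xs. xs ! 1 - 1)"
      by (intro recursive_comp1[OF computable_pred] recursive_nth) simp
  qed (simp_all add: computable_id)
  then show ?thesis by (rule recursive2_swap)
qed

text \<open>Unbounded search: totality of \<open>h\<close> makes every value before the first zero a
  defined successor, as \<open>run_Mu\<close> demands, and \<open>ex\<close> makes the search
  halt.\<close>

lemma computable_Least_zero:
  assumes "recursive2 h" and ex: "\<And>x. \<exists>n. h n x = 0"
  shows "computable (\<lambda>x. LEAST n. h n x = 0)"
proof -
  obtain e where e: "\<And>n x. run e [n, x] (h n x)"
    using assms(1) by (auto simp: recursive2_def)
  have "run (Mu e) [x] (LEAST n. h n x = 0)" for x
  proof (rule run_Mu)
    show "run e [LEAST n. h n x = 0, x] 0"
      using e[of "LEAST n. h n x = 0" x] LeastI_ex[OF ex[of x]] by simp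
  next
    fix m assume "m < (LEAST n. h n x = 0)"
    then have "h m x \<noteq> 0" by (rule not_less_Least)
    then show "\<exists>y. run e [m, x] (Suc y)"
      using e[of m x] by (metis not0_implies_Suc)
  qed
  then show ?thesis by (auto simp: computable_def)
qed

section \<open>Countability of the computable functions\<close>

instance recf :: countable
  by countable_datatype

text \<open>By determinism a program computes at most one function, so choosing a program for each
  computable function is injective.\<close>

lemma countable_computable: "countable {f. computable f}"
proof -
  define code where "code f = (SOME e. \<forall>x. run e [x] (f x))" for f
  have code: "run (code f) [x] (f x)" if "computable f" for f x
    using someI_ex[of "\<lambda>e. \<forall>x. run e [x] (f x)"] that by (auto simp: code_def computable_def)
  have "inj_on code {f. computable f}"
  proof (rule inj_onI)
    fix f g assume fg: "f \<in> {f. computable f}" "g \<in> {f. computable f}" "code f = code g"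
    then have "f x = g x" for x
      using code[of f x] code[of g x] by (auto intro: run_deterministic)
    then show "f = g" by blast
  qed
  then show ?thesis by (rule countableI')
qed

section \<open>The block-reversing permutation\<close>

text \<open>The ratio of consecutive levels of block \<open>j\<close>. It has to be at least
  \<open>2 * j * j\<close>: a factor \<open>2 * j\<close> is lost to heaviness, and a factor
  \<open>j\<close> must remain as the gain in sparsity.\<close>

definition scale :: "nat \<Rightarrow> nat" where
  "scale j = 2 * Suc j ^ 2"

text \<open>Block \<open>j\<close> is \<open>{bnd j..<bnd (Suc j)}\<close>. The successor keeps the
  product from staying at \<open>bnd 0 = 0\<close>.\<close>

primrec bnd :: "nat \<Rightarrow> nat" where
  "bnd 0 = 0"
| "bnd (Suc j) = Suc (bnd j) * scale j ^ Suc j"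

text \<open>Left end of level \<open>t\<close>, for \<open>t\<close> from \<open>0\<close> to
  \<open>j\<close>. As \<open>lev j 0 = Suc (bnd j)\<close>, the point \<open>bnd j\<close> lies in
  no level.\<close>

definition lev :: "nat \<Rightarrow> nat \<Rightarrow> nat" where
  "lev j t = Suc (bnd j) * scale j ^ t"

definition block :: "nat \<Rightarrow> nat" where
  "block x = (LEAST j. x < bnd (Suc j))"

definition flip :: "nat \<Rightarrow> nat" where
  "flip x = bnd (block x) + bnd (Suc (block x)) - Suc x"

lemma scale_ge_2: "2 \<le> scale j"
  by (simp add: scale_def)

lemma scale_pos: "0 < scale j"
  using scale_ge_2[of j] by linarith

lemma bnd_less_Suc: "bnd j < bnd (Suc j)"
proof -
  have "1 \<le> scale j ^ Suc j" using scale_pos[of j] by (simp add: Suc_leI)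
  then have "Suc (bnd j) * 1 \<le> Suc (bnd j) * scale j ^ Suc j" by (rule mult_le_mono2)
  then show ?thesis by simp
qed

lemma strict_mono_bnd: "strict_mono bnd"
  by (simp add: strict_mono_Suc_iff bnd_less_Suc del: bnd.simps)

lemma mono_bnd: "i \<le> j \<Longrightarrow> bnd i \<le> bnd j"
  using strict_mono_bnd by (simp add: strict_mono_less_eq)

lemma le_bnd: "j \<le> bnd j"
  using strict_mono_bnd by (rule strict_mono_imp_increasing)

lemma less_bnd_Suc_block: "x < bnd (Suc (block x))"
proof -
  have "x < bnd (Suc x)" using le_bnd[of "Suc x"] by linarith
  then show ?thesis unfolding block_def by (rule LeastI)
qed

lemma bnd_block_le: "bnd (block x) \<le> x"
proof (cases "block x")
  case (Suc j)
  then have "\<not> x < bnd (Suc j)"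
    using not_less_Least[of j "\<lambda>j. x < bnd (Suc j)"] by (simp add: block_def)
  then show ?thesis by (simp add: Suc)
qed simp

lemma block_unique:
  assumes "bnd j \<le> x" and "x < bnd (Suc j)"
  shows "block x = j"
proof (rule linorder_cases)
  assume "block x < j"
  then show ?thesis using mono_bnd[of "Suc (block x)" j] less_bnd_Suc_block[of x] assms by simp
next
  assume "j < block x"
  then show ?thesis using mono_bnd[of "Suc j" "block x"] bnd_block_le[of x] assms by simp
qed

lemma flip_eq:
  assumes "bnd j \<le> x" and "x < bnd (Suc j)"
  shows "flip x = bnd j + bnd (Suc j) - Suc x"
  by (simp only: flip_def block_unique[OF assms])

lemma flip_in_block:
  assumes "bnd j \<le> x" and "x < bnd (Suc j)"
  shows "bnd j \<le> flip x" and "flip x < bnd (Suc j)"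
  using assms flip_eq[OF assms] by linarith+

lemma flip_flip: "flip (flip x) = x"
proof -
  note x = bnd_block_le[of x] less_bnd_Suc_block[of x]
  show ?thesis
    using flip_eq[OF flip_in_block[OF x]] flip_eq[OF x] x by linarith
qed

lemma bij_flip: "bij flip"
  by (rule involuntory_imp_bij) (rule flip_flip)

lemma inj_on_flip: "inj_on flip S"
  using bij_flip by (auto simp: bij_def intro: inj_on_subset)

section \<open>Computability of the permutation\<close>

lemma computable_scale: "computable scale"
  unfolding computable_iff_recursive scale_def
  by (intro recursive_comp2[OF recursive2_times] recursive_comp2[OF recursive2_power]
      recursive_const recursive_Suc recursive_nth) simp

lemma computable_bnd: "computable bnd"
proof (rule computable_primrec)
  show "recursive2 (\<lambda>j y. Suc y * scale j ^ Suc j)"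
    unfolding recursive2_iff_recursive
    by (intro recursive_comp2[OF recursive2_times] recursive_comp2[OF recursive2_power]
      recursive_comp1[OF computable_scale] recursive_Suc recursive_nth) simp_all
qed simp

lemma computable_block: "computable block"
proof -
  \<comment> \<open>With truncated subtraction, \<open>x < b\<close> becomes the zero test
    \<open>Suc x - b = 0\<close>.\<close>
  have "computable (\<lambda>x. LEAST j. Suc x - bnd (Suc j) = 0)"
  proof (rule computable_Least_zero)
    show "recursive2 (\<lambda>j x. Suc x - bnd (Suc j))"
      unfolding recursive2_iff_recursive
      by (intro recursive_comp2[OF recursive2_minus] recursive_comp1[OF computable_bnd]
          recursive_Suc recursive_nth) simp_all
    show "\<exists>j. Suc x - bnd (Suc j) = 0" for x
      using less_bnd_Suc_block[of x] by (metis Suc_leI diff_is_0_eq)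
  qed
  moreover have "block = (\<lambda>x. LEAST j. Suc x - bnd (Suc j) = 0)"
    unfolding block_def by (simp add: Suc_le_eq del: bnd.simps)
  ultimately show ?thesis by simp
qed

lemma computable_flip: "computable flip"
  unfolding computable_iff_recursive flip_def
  by (intro recursive_comp2[OF recursive2_minus] recursive_comp2[OF recursive2_add]
      recursive_comp1[OF computable_bnd] recursive_comp1[OF computable_block]
      recursive_Suc recursive_nth) simp_all

section \<open>Levels of a block\<close>

text \<open>The set \<open>A\<close> is built inside these reversed levels, so that
  \<open>flip\<close> carries it back into the levels themselves.\<close>

definition seg :: "nat \<Rightarrow> nat \<Rightarrow> nat set" where
  "seg j t = flip ` {lev j t..<lev j (Suc t)}"

lemma lev_last: "lev j (Suc j) = bnd (Suc j)"
  by (simp add: lev_def)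

lemma lev_mono: "t \<le> u \<Longrightarrow> lev j t \<le> lev j u"
  unfolding lev_def using scale_pos[of j] by (intro mult_le_mono2 power_increasing) simp_all

lemma bnd_le_lev: "bnd j \<le> lev j t"
  using lev_mono[of 0 t j] by (simp add: lev_def)

lemma lev_le_bnd_Suc: "t \<le> Suc j \<Longrightarrow> lev j t \<le> bnd (Suc j)"
  using lev_mono[of t "Suc j" j] by (simp only: lev_last)

lemma finite_seg: "finite (seg j t)"
  by (simp add: seg_def)

lemma card_seg: "card (seg j t) = lev j t * (scale j - 1)"
proof -
  have "card (seg j t) = lev j (Suc t) - lev j t"
    by (simp add: seg_def card_image inj_on_flip)
  also have "lev j (Suc t) = lev j t * scale j"
    by (simp add: lev_def algebra_simps)
  also have "lev j t * scale j - lev j t = lev j t * (scale j - 1)"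
    by (simp add: diff_mult_distrib2)
  finally show ?thesis .
qed

lemma scale_mult_card_seg_le:
  assumes "t < u"
  shows "scale j * card (seg j t) \<le> card (seg j u)"
proof -
  have "scale j * lev j t = lev j (Suc t)" by (simp add: lev_def algebra_simps)
  also have "\<dots> \<le> lev j u" using assms by (intro lev_mono) simp
  finally have "scale j * lev j t * (scale j - 1) \<le> lev j u * (scale j - 1)" by (rule mult_le_mono1)
  then show ?thesis by (simp add: card_seg mult.assoc)
qed

lemma seg_subset_block:
  assumes "t \<le> j"
  shows "seg j t \<subseteq> {bnd j..<bnd (Suc j)}"
proof
  fix x assume "x \<in> seg j t"
  then obtain y where y: "x = flip y" "lev j t \<le> y" "y < lev j (Suc t)"
    by (auto simp: seg_def)
  have "bnd j \<le> y" "y < bnd (Suc j)"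
    using y bnd_le_lev[of j t] lev_le_bnd_Suc[of "Suc t" j] assms by linarith+
  then show "x \<in> {bnd j..<bnd (Suc j)}" using flip_in_block y(1) by auto
qed

text \<open>Reversal puts larger levels first; this order is what an increasing function cannot
  evade.\<close>

lemma seg_less:
  assumes "t < u" "u \<le> j" "x \<in> seg j t" "y \<in> seg j u"
  shows "y < x"
proof -
  obtain x' where x': "x = flip x'" "lev j t \<le> x'" "x' < lev j (Suc t)"
    using assms by (auto simp: seg_def)
  obtain y' where y': "y = flip y'" "lev j u \<le> y'" "y' < lev j (Suc u)"
    using assms by (auto simp: seg_def)
  have "lev j (Suc t) \<le> lev j u" using assms by (intro lev_mono) simp
  then have "x' < y'" using x' y' by linarith
  have bx: "bnd j \<le> x'" and "by": "y' < bnd (Suc j)"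
    using x' y' bnd_le_lev[of j t] lev_le_bnd_Suc[of "Suc u" j] assms by linarith+
  have "flip x' = bnd j + bnd (Suc j) - Suc x'" "flip y' = bnd j + bnd (Suc j) - Suc y'"
    using flip_eq bx "by" \<open>x' < y'\<close> by simp_all
  then show ?thesis using x' y' \<open>x' < y'\<close> "by" by linarith
qed

section \<open>Diagonalization within a block\<close>

text \<open>Call \<open>R i\<close> heavy at a level if it contains more than a fraction \<open>1 / (2 j)\<close> of it. All sets
  that are not heavy at level \<open>t\<close> can be removed from it together at the cost of half of its
  elements. A set that is heavy at \<open>t\<close> is harmless if it is heavy at a larger level too, because
  that one precedes \<open>t\<close> in the reversed block. So each of the \<open>j\<close> sets spoils only one of the
  \<open>j + 1\<close> levels, the largest at which it is heavy.\<close>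

lemma diagonal_block:
  fixes R :: "nat \<Rightarrow> nat set"
  shows "\<exists>S t. t \<le> j \<and> S \<subseteq> seg j t \<and> card (seg j t) \<le> 2 * card S \<and>
    (\<forall>i<j. S \<inter> R i = {} \<or> (\<exists>u. t < u \<and> u \<le> j \<and> card (seg j u) < 2 * j * card (seg j u \<inter> R i)))"
proof -
  define heavy where "heavy i u \<longleftrightarrow> card (seg j u) < 2 * j * card (seg j u \<inter> R i)" for i u
  \<comment> \<open>If \<open>R i\<close> is heavy nowhere, this is an unspecified maximum of the
    empty set: the pigeonhole count is unaffected, and \<open>above\<close> uses the value only for
    sets heavy at \<open>t\<close>.\<close>
  define top where "top i = Max {u. u \<le> j \<and> heavy i u}" for i
  have "card (top ` {..<j}) < card {..j}"
    using card_image_le[of "{..<j}" top] by simp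
  then have "\<not> {..j} \<subseteq> top ` {..<j}"
    by (metis card_mono finite_imageI finite_lessThan not_le)
  then obtain t where t: "t \<le> j" "\<And>i. i < j \<Longrightarrow> t \<noteq> top i" by auto
  have above: "\<exists>u. t < u \<and> u \<le> j \<and> heavy i u" if "i < j" "heavy i t" for i
  proof -
    let ?U = "{u. u \<le> j \<and> heavy i u}"
    have fin: "finite ?U" by simp
    have "t \<in> ?U" using that t by simp
    then have "top i \<in> ?U" "t \<le> top i"
      unfolding top_def using Max_in[OF fin] Max_ge[OF fin] by blast+
    then show ?thesis using t(2)[OF that(1)] by (intro exI[of _ "top i"]) auto
  qed
  define I where "I = {i. i < j \<and> \<not> heavy i t}"
  define D where "D = (\<Union>i\<in>I. seg j t \<inter> R i)"
  have finI: "finite I" and cardI: "card I \<le> j"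
    using card_mono[of "{..<j}" I] by (auto simp: I_def)
  have D: "2 * card D \<le> card (seg j t)"
  proof (cases "j = 0")
    case True
    then show ?thesis by (simp add: D_def I_def)
  next
    case False
    have "card D \<le> (\<Sum>i\<in>I. card (seg j t \<inter> R i))"
      unfolding D_def using finI by (rule card_UN_le)
    then have "j * (2 * card D) \<le> (\<Sum>i\<in>I. 2 * j * card (seg j t \<inter> R i))"
      by (simp add: sum_distrib_left[symmetric])
    also have "\<dots> \<le> (\<Sum>i\<in>I. card (seg j t))"
      by (rule sum_mono) (simp add: I_def heavy_def)
    also have "\<dots> \<le> j * card (seg j t)" using cardI by simp
    finally show ?thesis using False by simp
  qed
  have sub: "D \<subseteq> seg j t" by (auto simp: D_def)
  have "card (seg j t - D) = card (seg j t) - card D"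
    using sub finite_seg by (intro card_Diff_subset) (auto intro: finite_subset)
  then have "card (seg j t) \<le> 2 * card (seg j t - D)" using D by linarith
  moreover have "(seg j t - D) \<inter> R i = {} \<or> (\<exists>u. t < u \<and> u \<le> j \<and> heavy i u)" if "i < j" for i
    using above[OF that] that by (cases "heavy i t") (auto simp: D_def I_def)
  ultimately show ?thesis
    using t(1) by (intro exI[of _ "seg j t - D"] exI[of _ t]) (auto simp: heavy_def)
qed

section \<open>Preimages under increasing functions\<close>

lemma card_vimage_strict_mono:
  fixes f :: "nat \<Rightarrow> nat"
  assumes "strict_mono f"
  shows "card (f -` S) = card (S \<inter> range f)"
  using card_vimage_inj_on_le card_image[of f "f -` S"] strict_mono_imp_inj_on[OF assms]
  by (metis image_vimage_eq inj_on_subset subset_UNIV)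

lemma finite_vimage_strict_mono:
  fixes f :: "nat \<Rightarrow> nat"
  assumes "strict_mono f" "finite S"
  shows "finite (f -` S)"
  using assms by (intro finite_vimageI strict_mono_imp_inj_on)

text \<open>Once \<open>f\<close> has reached \<open>S\<close> before \<open>n\<close>, monotonicity
  puts the whole preimage of the larger level \<open>u\<close> below \<open>n\<close>. That preimage
  has more than \<open>card (seg j u) / (2 * j)\<close> elements, whereas \<open>S\<close> lies in a
  level smaller by a factor of at least \<open>scale j\<close>.\<close>

lemma sparse_in_block:
  fixes f :: "nat \<Rightarrow> nat"
  assumes f: "strict_mono f" and "t \<le> j" and S: "S \<subseteq> seg j t"
    and alt: "S \<inter> range f = {} \<or>
      (\<exists>u. t < u \<and> u \<le> j \<and> card (seg j u) < 2 * j * card (seg j u \<inter> range f))"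
  shows "j * card (f -` S \<inter> {..<n}) \<le> card (f -` {bnd j..<bnd (Suc j)} \<inter> {..<n})"
proof (cases "f -` S \<inter> {..<n} = {}")
  case False
  then obtain x where x: "x < n" "f x \<in> S" by auto
  then obtain u where u: "t < u" "u \<le> j" "card (seg j u) < 2 * j * card (seg j u \<inter> range f)"
    using alt by auto
  have "j \<noteq> 0" using u by auto
  have early: "f -` seg j u \<subseteq> f -` {bnd j..<bnd (Suc j)} \<inter> {..<n}"
  proof
    fix y assume y: "y \<in> f -` seg j u"
    then have "f y < f x" using seg_less[of t u j "f x" "f y"] u x S by auto
    then have "y < x" using f by (simp add: strict_mono_less)
    then show "y \<in> f -` {bnd j..<bnd (Suc j)} \<inter> {..<n}"
      using y x seg_subset_block[OF u(2)] by auto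
  qed
  have "card (f -` S \<inter> {..<n}) \<le> card (f -` seg j t)"
    using S by (intro card_mono finite_vimage_strict_mono f finite_seg) auto
  also have "\<dots> \<le> card (seg j t)"
    unfolding card_vimage_strict_mono[OF f] by (intro card_mono finite_seg) auto
  finally have "scale j * card (f -` S \<inter> {..<n}) \<le> scale j * card (seg j t)" by simp
  also have "\<dots> \<le> card (seg j u)" using u(1) by (rule scale_mult_card_seg_le)
  also have "\<dots> \<le> 2 * j * card (f -` seg j u)"
    using u(3) by (simp add: card_vimage_strict_mono[OF f])
  also have "\<dots> \<le> 2 * j * card (f -` {bnd j..<bnd (Suc j)} \<inter> {..<n})"
    using early by (intro mult_le_mono2 card_mono) auto
  finally have *: "scale j * card (f -` S \<inter> {..<n})
      \<le> 2 * j * card (f -` {bnd j..<bnd (Suc j)} \<inter> {..<n})" .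
  have "2 * j * j \<le> scale j" by (simp add: scale_def power2_eq_square)
  then have "2 * j * j * card (f -` S \<inter> {..<n}) \<le> scale j * card (f -` S \<inter> {..<n})"
    by (rule mult_le_mono1)
  with * have "(2 * j) * (j * card (f -` S \<inter> {..<n}))
      \<le> (2 * j) * card (f -` {bnd j..<bnd (Suc j)} \<inter> {..<n})"
    by (simp only: mult.assoc)
  then show ?thesis using \<open>j \<noteq> 0\<close> by simp
qed simp

lemma blocks_disjoint:
  "i \<noteq> j \<Longrightarrow> {bnd i..<bnd (Suc i)} \<inter> {bnd j..<bnd (Suc j)} = {}"
  using block_unique by (metis atLeastLessThan_iff disjoint_iff)

text \<open>Values below \<open>bnd m\<close> are taken at most \<open>bnd m\<close> times. In each
  later block the preimage of \<open>S j\<close> is at most a fraction \<open>1 / m\<close> of the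
  preimage of the block, and these block preimages are disjoint.\<close>

lemma card_vimage_UN_le:
  fixes f :: "nat \<Rightarrow> nat"
  assumes f: "strict_mono f" and S: "\<And>j. S j \<subseteq> {bnd j..<bnd (Suc j)}"
    and sparse: "\<And>j. m \<le> j \<Longrightarrow>
      j * card (f -` S j \<inter> {..<n}) \<le> card (f -` {bnd j..<bnd (Suc j)} \<inter> {..<n})"
  shows "m * card (f -` (\<Union>j. S j) \<inter> {..<n}) \<le> m * bnd m + n"
proof -
  \<comment> \<open>A finite index set suffices: \<open>x < n\<close> and \<open>f x\<close> in
    \<open>S j\<close> give \<open>j \<le> bnd j \<le> f x < f n\<close>.\<close>
  define J where "J = {m..<f n}"
  let ?B = "\<lambda>j. f -` {bnd j..<bnd (Suc j)} \<inter> {..<n}"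
  have "f -` (\<Union>j. S j) \<inter> {..<n} \<subseteq> f -` {..<bnd m} \<union> (\<Union>j\<in>J. f -` S j \<inter> {..<n})"
  proof
    fix x assume x: "x \<in> f -` (\<Union>j. S j) \<inter> {..<n}"
    then obtain j where j: "f x \<in> S j" by auto
    then have b: "bnd j \<le> f x" "f x < bnd (Suc j)" using S by fastforce+
    have "f x < f n" using x f by (simp add: strict_mono_less)
    then have jn: "j < f n" using le_bnd[of j] b by linarith
    show "x \<in> f -` {..<bnd m} \<union> (\<Union>j\<in>J. f -` S j \<inter> {..<n})"
    proof (cases "m \<le> j")
      case True
      then show ?thesis using j x jn by (auto simp: J_def)
    next
      case False
      then have "bnd (Suc j) \<le> bnd m" by (intro mono_bnd) simp
      then have "f x < bnd m" using b by linarith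
      then show ?thesis by simp
    qed
  qed
  then have "card (f -` (\<Union>j. S j) \<inter> {..<n})
      \<le> card (f -` {..<bnd m} \<union> (\<Union>j\<in>J. f -` S j \<inter> {..<n}))"
    by (rule card_mono[rotated]) (auto simp: J_def intro: finite_vimage_strict_mono f)
  also have "\<dots> \<le> card (f -` {..<bnd m}) + card (\<Union>j\<in>J. f -` S j \<inter> {..<n})"
    by (rule card_Un_le)
  also have "card (f -` {..<bnd m}) \<le> bnd m"
    unfolding card_vimage_strict_mono[OF f]
    using card_mono[of "{..<bnd m}" "{..<bnd m} \<inter> range f"] by simp
  also have "card (\<Union>j\<in>J. f -` S j \<inter> {..<n}) \<le> (\<Sum>j\<in>J. card (f -` S j \<inter> {..<n}))"
    by (rule card_UN_le) (simp add: J_def)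
  finally have "m * card (f -` (\<Union>j. S j) \<inter> {..<n})
      \<le> m * bnd m + (\<Sum>j\<in>J. m * card (f -` S j \<inter> {..<n}))"
    by (simp flip: sum_distrib_left distrib_left)
  also have "(\<Sum>j\<in>J. m * card (f -` S j \<inter> {..<n})) \<le> (\<Sum>j\<in>J. card (?B j))"
  proof (rule sum_mono)
    fix j assume "j \<in> J"
    then have "m \<le> j" by (simp add: J_def)
    then show "m * card (f -` S j \<inter> {..<n}) \<le> card (?B j)"
      using sparse[of j] mult_le_mono1[of m j "card (f -` S j \<inter> {..<n})"] by linarith
  qed
  also have "(\<Sum>j\<in>J. card (?B j)) = card (\<Union>j\<in>J. ?B j)"
  proof (rule card_UN_disjoint[symmetric])
    show "\<forall>i\<in>J. \<forall>j\<in>J. i \<noteq> j \<longrightarrow> ?B i \<inter> ?B j = {}"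
      using blocks_disjoint by blast
  qed (auto simp: J_def)
  also have "\<dots> \<le> n"
    using card_mono[of "{..<n}" "\<Union>j\<in>J. ?B j"] by auto
  finally show ?thesis by simp
qed

section \<open>Densities\<close>

lemma partial_density_nonneg: "0 \<le> partial_density A n"
  by (simp add: partial_density_def)

lemma lower_density_nonneg: "0 \<le> lower_density A"
  unfolding lower_density_def
  by (rule Liminf_bounded) (simp add: partial_density_nonneg zero_ereal_def)

lemma lower_le_upper_density: "lower_density A \<le> upper_density A"
  unfolding lower_density_def upper_density_def by (rule Liminf_le_Limsup) simp

text \<open>The bound says that the partial density is at most \<open>1 / m\<close> up to a term
  vanishing with \<open>n\<close>. The threshold \<open>M\<close> is there because a given function
  is controlled only from some block on.\<close>

lemma upper_density_eq_0:
  assumes "\<And>m. M \<le> m \<Longrightarrow> \<exists>c. \<forall>n. m * card (A \<inter> {..<n}) \<le> c + n"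
  shows "upper_density A = 0"
proof -
  have "(\<lambda>n. partial_density A n) \<longlonglongrightarrow> 0"
  proof (rule LIMSEQ_I)
    fix e :: real assume "0 < e"
    \<comment> \<open>For \<open>n > c\<close> the count is below \<open>2 * n / m\<close>, hence
      the density is below \<open>2 / m < e\<close>.\<close>
    obtain m0 :: nat where m0: "2 / e < real m0" using reals_Archimedean2 by blast
    define m where "m = max m0 (max 1 M)"
    have m: "M \<le> m" "0 < m" "2 / e < real m" using m0 by (auto simp: m_def)
    obtain c where c: "\<And>n. m * card (A \<inter> {..<n}) \<le> c + n" using assms[OF m(1)] by blast
    have "norm (partial_density A n - 0) < e" if n: "Suc c \<le> n" for n
    proof -
      have "real m * real (card (A \<inter> {..<n})) \<le> real c + real n"
        using c[of n] by (metis of_nat_add of_nat_le_iff of_nat_mult)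
      also have "\<dots> < 2 * real n" using n by simp
      also have "\<dots> \<le> (real m * e) * real n"
        using m \<open>0 < e\<close> by (intro mult_right_mono) (simp_all add: field_simps)
      finally have "real m * real (card (A \<inter> {..<n})) < real m * (e * real n)"
        by (simp add: mult.assoc)
      then have "real (card (A \<inter> {..<n})) < e * real n" using m(2) by simp
      then show ?thesis using n by (simp add: partial_density_def field_simps)
    qed
    then show "\<exists>N. \<forall>n\<ge>N. norm (partial_density A n - 0) < e" by blast
  qed
  then have "(\<lambda>n. ereal (partial_density A n)) \<longlonglongrightarrow> ereal 0" by simp
  then show ?thesis
    unfolding upper_density_def by (metis lim_imp_Limsup trivial_limit_sequentially zero_ereal_def)
qed

text \<open>The constant 4 is two halvings: a level fills at least half of the initial segment
  ending with it, and the chosen set at least half of the level.\<close>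

lemma upper_density_pos:
  assumes "\<And>k. \<exists>n\<ge>k. 0 < n \<and> n \<le> 4 * card (A \<inter> {..<n})"
  shows "upper_density A \<noteq> 0"
proof
  assume "upper_density A = 0"
  then have "upper_density A < ereal (1/4)" by simp
  then have "eventually (\<lambda>n. ereal (partial_density A n) < ereal (1/4)) sequentially"
    unfolding upper_density_def by (rule Limsup_lessD)
  then obtain k where k: "\<And>n. k \<le> n \<Longrightarrow> partial_density A n < 1/4"
    by (auto simp: eventually_sequentially)
  obtain n where n: "k \<le> n" "0 < n" "n \<le> 4 * card (A \<inter> {..<n})" using assms by blast
  have "real n \<le> 4 * real (card (A \<inter> {..<n}))" using n(3) by linarith
  then have "1/4 \<le> partial_density A n" using n(2) by (simp add: partial_density_def field_simps)
  then show False using k[OF n(1)] by simp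
qed

lemma computably_small_if:
  assumes "\<And>f. computable f \<Longrightarrow> strict_mono f \<Longrightarrow> upper_density (f -` A) = 0"
  shows "computably_small A"
proof -
  let ?F = "{f :: nat \<Rightarrow> nat. computable f \<and> strict_mono f}"
  \<comment> \<open>Over an empty index set the supremum and infimum of the constant 0 would be
    infinite.\<close>
  have ne: "?F \<noteq> {}" using computable_id by (auto intro: exI[of _ "\<lambda>x. x"] simp: strict_mono_def)
  have "lower_density (f -` A) = 0" if "f \<in> ?F" for f
    using assms[of f] that lower_le_upper_density[of "f -` A"] lower_density_nonneg[of "f -` A"]
    by (simp add: order.antisym)
  then have "computable_lower_density A = (INF f\<in>?F. 0)"
    unfolding computable_lower_density_def by (intro INF_cong) auto
  moreover have "computable_upper_density A = (SUP f\<in>?F. 0)"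
    unfolding computable_upper_density_def using assms by (intro SUP_cong) auto
  ultimately show ?thesis
    using ne by (simp add: computably_small_def has_computable_density_def)
qed

section \<open>Construction of the set and its two properties\<close>

theorem theorem1: "\<exists>A :: nat set. computably_small A \<and> \<not> intrinsically_small A"
proof -
  let ?F = "{f :: nat \<Rightarrow> nat. computable f \<and> strict_mono f}"
  define F where "F = from_nat_into ?F"
  have "countable ?F" by (rule countable_subset[OF _ countable_computable]) auto
  then have F: "\<exists>i. f = F i" if "f \<in> ?F" for f
    using that unfolding F_def by (metis from_nat_into_surj)
  obtain S t where St: "\<And>j. t j \<le> j" "\<And>j. S j \<subseteq> seg j (t j)"
    "\<And>j. card (seg j (t j)) \<le> 2 * card (S j)"
    and alt: "\<And>i j. i < j \<Longrightarrow> S j \<inter> range (F i) = {} \<or>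
      (\<exists>u. t j < u \<and> u \<le> j \<and> card (seg j u) < 2 * j * card (seg j u \<inter> range (F i)))"
    using diagonal_block[of _ "\<lambda>i. range (F i)"] by metis
  define A where "A = (\<Union>j. S j)"
  have "upper_density (f -` A) = 0" if comp: "computable f" and f: "strict_mono f" for f
  proof -
    obtain i where i: "f = F i" using F[of f] comp f by auto
    \<comment> \<open>Blocks \<open>j \<ge> m > i\<close> are those whose diagonalization takes
      \<open>F i\<close> into account.\<close>
    have "m * card (f -` A \<inter> {..<n}) \<le> m * bnd m + n" if "Suc i \<le> m" for m n
      unfolding A_def
    proof (rule card_vimage_UN_le[OF f])
      show "S j \<subseteq> {bnd j..<bnd (Suc j)}" for j
        using St(2) seg_subset_block[OF St(1)] by (rule order.trans)
      show "j * card (f -` S j \<inter> {..<n}) \<le> card (f -` {bnd j..<bnd (Suc j)} \<inter> {..<n})"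
        if "m \<le> j" for j
        using alt[of i j] that \<open>Suc i \<le> m\<close> St(1,2) i by (intro sparse_in_block[OF f, of "t j"]) auto
    qed
    then show ?thesis by (intro upper_density_eq_0[of "Suc i"]) blast
  qed
  then have "computably_small A" by (rule computably_small_if)
  moreover have "upper_density (flip ` A) \<noteq> 0"
  proof (rule upper_density_pos)
    fix k
    \<comment> \<open>The right end of the chosen level, where that level dominates everything
      before it.\<close>
    define n where "n = lev k (Suc (t k))"
    have "k \<le> n" using le_bnd[of k] bnd_le_lev[of k "Suc (t k)"] by (simp add: n_def)
    moreover have "0 < n" using scale_pos by (simp add: n_def lev_def)
    moreover have "n \<le> 4 * card (flip ` A \<inter> {..<n})"
    proof -
      have "flip ` seg k (t k) = {lev k (t k)..<n}"
        by (simp add: seg_def image_image flip_flip n_def)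
      then have "flip ` S k \<subseteq> flip ` A \<inter> {..<n}"
        using St(2)[of k] unfolding A_def by fastforce
      then have "card (S k) \<le> card (flip ` A \<inter> {..<n})"
        using card_mono[of "flip ` A \<inter> {..<n}" "flip ` S k"]
        by (simp add: card_image inj_on_flip)
      moreover have "n \<le> 2 * card (seg k (t k))"
      proof -
        have "n = lev k (t k) * scale k" by (simp add: n_def lev_def algebra_simps)
        also have "\<dots> \<le> lev k (t k) * (2 * (scale k - 1))"
          using scale_ge_2[of k] by (intro mult_le_mono2) linarith
        finally show ?thesis by (simp add: card_seg mult.left_commute)
      qed
      ultimately show ?thesis using St(3)[of k] by linarith
    qed
    ultimately show "\<exists>n\<ge>k. 0 < n \<and> n \<le> 4 * card (flip ` A \<inter> {..<n})" by blast
  qed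
  then have "\<not> intrinsically_small A"
    using computable_flip bij_flip
    by (auto simp: intrinsically_small_def has_intrinsic_density_def has_density_def zero_ereal_def)
  ultimately show ?thesis by blast
qed

end
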